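(* Let $G=M\circ_Z N$ and suppose that $Z$ has a normal transversal $Y$ in $N$. Then $G=M\times Y$. In particular, if $N$ is an abelian group, and $Y$ is any transversal of $Z$ in $N$, then $G=M\times Y$.
   Context: Groups may be infinite. A subset of a group is normal if it is invariant under conjugation by all elements of the group. Set-direct product: for a group $G$ and non-empty subsets $X,Y\subseteq G$, the setwise product $XY$ is called direct, and is then written $X\times Y$, if both $X$ and $Y$ are normal in $G$ and every $g\in XY$ has a unique representation $g=xy$ with $x\in X$, $y\in Y$. Central product: $G=M\circ_Z N$ means that $M,N$ are subgroups of $G$ with $G=MN$, $M$ and $N$ centralize each other, and $Z=M\cap N$ (then $M,N$ are normal and $Z$ is central in $G$). A transversal of $Z$ in $N$ is a subset of $N$ containing exactly one element of each coset of $Z$ in $N$; it is a normal transversal if it is a normal subset of $N$. *)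

theory Defs
  imports "HOL-Algebra.Coset"
begin

definition normal_subset :: "('a, 'b) monoid_scheme \<Rightarrow> 'a set \<Rightarrow> bool" where
  "normal_subset G X \<longleftrightarrow>
     X \<subseteq> carrier G \<and>
     (\<forall>g \<in> carrier G. (\<lambda>x. g \<otimes>\<^bsub>G\<^esub> x \<otimes>\<^bsub>G\<^esub> inv\<^bsub>G\<^esub> g) ` X = X)"

definition set_direct :: "('a, 'b) monoid_scheme \<Rightarrow> 'a set \<Rightarrow> 'a set \<Rightarrow> bool" where
  "set_direct G X Y \<longleftrightarrow>
     X \<noteq> {} \<and> Y \<noteq> {} \<and> normal_subset G X \<and> normal_subset G Y \<and>
     (\<forall>g \<in> X <#>\<^bsub>G\<^esub> Y. \<exists>!p. p \<in> X \<times> Y \<and> g = fst p \<otimes>\<^bsub>G\<^esub> snd p)"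

definition is_set_direct_product :: "('a, 'b) monoid_scheme \<Rightarrow> 'a set \<Rightarrow> 'a set \<Rightarrow> bool" where
  "is_set_direct_product G X Y \<longleftrightarrow> set_direct G X Y \<and> carrier G = X <#>\<^bsub>G\<^esub> Y"

definition central_product ::
    "('a, 'b) monoid_scheme \<Rightarrow> 'a set \<Rightarrow> 'a set \<Rightarrow> 'a set \<Rightarrow> bool" where
  "central_product G M Z N \<longleftrightarrow>
     subgroup M G \<and> subgroup N G \<and> carrier G = M <#>\<^bsub>G\<^esub> N \<and>
     (\<forall>m \<in> M. \<forall>n \<in> N. m \<otimes>\<^bsub>G\<^esub> n = n \<otimes>\<^bsub>G\<^esub> m) \<and> Z = M \<inter> N"

text \<open>
  A transversal of \<open>Z\<close> in \<open>G\<close>. It is phrased with right cosets; this makes no difference for the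
  central subgroups \<open>Z\<close> of interest here. For a transversal of \<open>Z\<close> in a subgroup \<open>N\<close> of \<open>G\<close>, the
  structure argument is \<open>G\<lparr>carrier := N\<rparr>\<close>.
\<close>

definition transversal :: "('a, 'b) monoid_scheme \<Rightarrow> 'a set \<Rightarrow> 'a set \<Rightarrow> bool" where
  "transversal G Z Y \<longleftrightarrow>
     Y \<subseteq> carrier G \<and> (\<forall>C \<in> rcosets\<^bsub>G\<^esub> Z. \<exists>!y. y \<in> Y \<inter> C)"

definition normal_transversal :: "('a, 'b) monoid_scheme \<Rightarrow> 'a set \<Rightarrow> 'a set \<Rightarrow> bool" where
  "normal_transversal G Z Y \<longleftrightarrow> transversal G Z Y \<and> normal_subset G Y"

end

theory Submission
  imports Defs
begin

text \<open>
  Conjugation by \<open>m n\<close> acts on \<open>M\<close> as conjugation by \<open>m\<close> and on \<open>N\<close> as conjugation by \<open>n\<close>, so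
  subsets of \<open>N\<close> that are normal in \<open>N\<close> are normal in \<open>G\<close>. If \<open>m y = m' y'\<close> with \<open>y, y'\<close> in \<open>Y\<close>,
  then the inverse of \<open>m'\<close> times \<open>m\<close> lies in \<open>M\<close> and in \<open>N\<close>, so \<open>y\<close> and \<open>y'\<close> lie in the same coset
  of \<open>Z\<close> and coincide.
\<close>

text \<open>Closure under conjugation already gives equality of the image with \<open>X\<close>:
  each \<open>x\<close> is the conjugate by \<open>g\<close> of its own conjugate by
  \<open>inv g\<close>, which again lies in \<open>X\<close>.\<close>

lemma (in group) normal_subsetI:
  assumes "X \<subseteq> carrier G"
    and conj: "\<And>g x. \<lbrakk>g \<in> carrier G; x \<in> X\<rbrakk> \<Longrightarrow> g \<otimes> x \<otimes> inv g \<in> X"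
  shows "normal_subset G X"
  unfolding normal_subset_def
proof (intro conjI ballI equalityI subsetI)
  fix g x assume g: "g \<in> carrier G" and x: "x \<in> X"
  have "x = g \<otimes> (inv g \<otimes> x \<otimes> inv (inv g)) \<otimes> inv g"
    using g x assms(1) by (auto simp: m_assoc subsetD) (simp add: m_assoc[symmetric] subsetD)
  then show "x \<in> (\<lambda>x. g \<otimes> x \<otimes> inv g) ` X"
    using conj[of "inv g" x] g x by blast
qed (use assms in auto)

lemma (in group) normal_subset_subgroupD:
  assumes "subgroup N G" "normal_subset (G\<lparr>carrier := N\<rparr>) Y" "n \<in> N" "y \<in> Y"
  shows "n \<otimes> y \<otimes> inv n \<in> Y"
  using assms by (auto simp: normal_subset_def m_inv_consistent)

lemma (in comm_group) normal_subset_if_subset: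
  assumes "X \<subseteq> carrier G"
  shows "normal_subset G X"
proof (rule normal_subsetI[OF assms])
  fix g x assume "g \<in> carrier G" "x \<in> X"
  then show "g \<otimes> x \<otimes> inv g \<in> X"
    using assms by (simp add: m_comm[of g x] m_assoc subsetD)
qed

text \<open>A right factor that commutes with \<open>x\<close> cancels against its inverse. This
  strips the \<open>N\<close>-part of a conjugating element acting on \<open>M\<close>, and the
  \<open>M\<close>-part of one acting on \<open>Y\<close>.\<close>

lemma (in group) conj_mult_commute_right:
  assumes "a \<in> carrier G" "b \<in> carrier G" "x \<in> carrier G" "b \<otimes> x = x \<otimes> b"
  shows "(a \<otimes> b) \<otimes> x \<otimes> inv (a \<otimes> b) = a \<otimes> x \<otimes> inv a"
proof -
  have "(a \<otimes> b) \<otimes> x \<otimes> inv (a \<otimes> b) = a \<otimes> (b \<otimes> x) \<otimes> inv b \<otimes> inv a"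
    using assms(1-3) by (simp add: inv_mult_group m_assoc)
  also have "\<dots> = a \<otimes> x \<otimes> inv a"
    unfolding assms(4) using assms(1-3) by (simp add: m_assoc)
  finally show ?thesis .
qed

text \<open>Right cosets depend only on the multiplication, which restricting the carrier to
  \<open>N\<close> leaves unchanged.\<close>

lemma transversal_carrier_unique:
  assumes "transversal (G\<lparr>carrier := N\<rparr>) Z Y" "n \<in> N"
  shows "\<exists>!y. y \<in> Y \<inter> (Z #>\<^bsub>G\<^esub> n)"
  using assms by (auto simp: transversal_def RCOSETS_def r_coset_def)

text \<open>Normality of \<open>Y\<close> is kept as a separate hypothesis so that the abelian case
  can supply it from commutativity of \<open>N\<close>.\<close>

lemma (in group) central_product_normal_transversal:
  assumes cp: "central_product G M Z N"
    and tr: "transversal (G\<lparr>carrier := N\<rparr>) Z Y"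
    and nY: "normal_subset (G\<lparr>carrier := N\<rparr>) Y"
  shows "is_set_direct_product G M Y"
proof -
  have M: "subgroup M G" and N: "subgroup N G" and G: "carrier G = M <#> N"
    and comm: "\<And>m n. \<lbrakk>m \<in> M; n \<in> N\<rbrakk> \<Longrightarrow> m \<otimes> n = n \<otimes> m" and Zeq: "Z = M \<inter> N"
    using cp by (auto simp: central_product_def)
  have Z: "subgroup Z G"
    using M N Zeq subgroups_Inter_pair by simp
  note [simp] = subgroup.mem_carrier[OF M] subgroup.mem_carrier[OF N]
  have YN: "y \<in> N" if "y \<in> Y" for y
    using tr that by (auto simp: transversal_def)
  have decomp: "\<exists>m\<in>M. \<exists>n\<in>N. g = m \<otimes> n" if "g \<in> carrier G" for g
    using that G by (auto simp: set_mult_def)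
  note coset = transversal_carrier_unique[OF tr]

  have nM: "normal_subset G M"
  proof (rule normal_subsetI[OF subgroup.subset[OF M]])
    fix g x assume "g \<in> carrier G" and x: "x \<in> M"
    then obtain m n where mn: "m \<in> M" "n \<in> N" "g = m \<otimes> n" using decomp by blast
    then have "g \<otimes> x \<otimes> inv g = m \<otimes> x \<otimes> inv m"
      using x comm[of x n] by (simp add: conj_mult_commute_right)
    then show "g \<otimes> x \<otimes> inv g \<in> M"
      using mn x M by (simp add: subgroup.m_closed subgroup.m_inv_closed)
  qed
  have nGY: "normal_subset G Y"
  proof (rule normal_subsetI)
    show "Y \<subseteq> carrier G" using YN by auto
    fix g y assume "g \<in> carrier G" and y: "y \<in> Y"
    \<comment> \<open>The factors are swapped here so that \<open>m\<close>, the one centralizing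
      \<open>y\<close>, stands on the right.\<close>
    then obtain m n where mn: "m \<in> M" "n \<in> N" "g = n \<otimes> m" using decomp comm by metis
    then have "g \<otimes> y \<otimes> inv g = n \<otimes> y \<otimes> inv n"
      using YN[OF y] comm[of m y] by (simp add: conj_mult_commute_right)
    then show "g \<otimes> y \<otimes> inv g \<in> Y"
      using normal_subset_subgroupD[OF N nY] mn y by simp
  qed

  have cover: "g \<in> M <#> Y" if g: "g \<in> carrier G" for g
  proof -
    obtain m n where mn: "m \<in> M" "n \<in> N" "g = m \<otimes> n" using decomp[OF g] by blast
    obtain y where y: "y \<in> Y" "y \<in> Z #> n" using coset[OF mn(2)] by blast
    then obtain z where z: "z \<in> Z" "y = z \<otimes> n" by (auto simp: r_coset_def)
    \<comment> \<open>Since \<open>n\<close> equals \<open>inv z \<otimes> y\<close> and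
      \<open>z\<close> lies in \<open>M\<close>, the correction \<open>inv z\<close> can be absorbed
      into the \<open>M\<close>-factor.\<close>
    have zM: "z \<in> M" using z Zeq by simp
    have "g = (m \<otimes> inv z) \<otimes> y"
      using mn z(2) zM by (simp add: m_assoc) (simp add: m_assoc[symmetric])
    moreover have "m \<otimes> inv z \<in> M"
      using mn zM M by (simp add: subgroup.m_closed subgroup.m_inv_closed)
    ultimately show ?thesis using y(1) by (auto simp: set_mult_def)
  qed
  have MY: "carrier G = M <#> Y"
    using cover YN by (auto simp: set_mult_def)

  have unique: "m = m' \<and> y = y'"
    if "m \<in> M" "m' \<in> M" "y \<in> Y" "y' \<in> Y" and eq: "m \<otimes> y = m' \<otimes> y'" for m m' y y'
  proof -
    have y: "y \<in> N" "y' \<in> N" using that YN by auto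
    define z where "z = inv m' \<otimes> m"
    have zM: "z \<in> M"
      unfolding z_def using that M by (simp add: subgroup.m_closed subgroup.m_inv_closed)
    have zy: "z \<otimes> y = y'"
      unfolding z_def using that y by (simp add: m_assoc) (simp add: m_assoc[symmetric])
    then have "z = y' \<otimes> inv y"
      using zM y by (simp add: inv_solve_right)
    then have "z \<in> N"
      using y N by (simp add: subgroup.m_closed subgroup.m_inv_closed)
    then have "y' \<in> Z #> y"
      using zM zy Zeq by (auto simp: r_coset_def)
    moreover have "y \<in> Z #> y"
      using y Z by (simp add: rcos_self)
    ultimately have "y = y'"
      using coset[OF y(1)] that by blast
    then show ?thesis using eq that y by simp
  qed

  \<comment> \<open>\<open>Y\<close> is non-empty because it meets the coset of the
    identity.\<close>
  have "M \<noteq> {}" "Y \<noteq> {}"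
    using subgroup.one_closed[OF M] coset[OF subgroup.one_closed[OF N]] by auto
  moreover have "\<exists>!p. p \<in> M \<times> Y \<and> g = fst p \<otimes> snd p" if g: "g \<in> M <#> Y" for g
  proof -
    obtain m y where "m \<in> M" "y \<in> Y" "g = m \<otimes> y"
      using g by (auto simp: set_mult_def)
    then show ?thesis
      by (intro ex1I[of _ "(m, y)"]) (use unique in auto)
  qed
  ultimately show ?thesis
    using nM nGY MY by (simp add: is_set_direct_product_def set_direct_def)
qed

theorem corollary1p8:
  fixes G :: "('a, 'b) monoid_scheme" and M N Z :: "'a set"
  assumes "group G"
    and "central_product G M Z N"
  shows "(\<forall>Y. normal_transversal (G\<lparr>carrier := N\<rparr>) Z Y \<longrightarrow> is_set_direct_product G M Y) \<and>
         (comm_group (G\<lparr>carrier := N\<rparr>) \<longrightarrow>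
           (\<forall>Y. transversal (G\<lparr>carrier := N\<rparr>) Z Y \<longrightarrow> is_set_direct_product G M Y))"
proof (intro conjI impI allI)
  fix Y assume "normal_transversal (G\<lparr>carrier := N\<rparr>) Z Y"
  then show "is_set_direct_product G M Y"
    using group.central_product_normal_transversal[OF assms] by (simp add: normal_transversal_def)
next
  fix Y assume "comm_group (G\<lparr>carrier := N\<rparr>)" and Y: "transversal (G\<lparr>carrier := N\<rparr>) Z Y"
  \<comment> \<open>Conjugation inside the abelian group \<open>N\<close> is trivial, so containment
    in \<open>N\<close> already makes \<open>Y\<close> normal in \<open>N\<close>.\<close>
  moreover have "Y \<subseteq> carrier (G\<lparr>carrier := N\<rparr>)"
    using Y by (simp add: transversal_def)
  ultimately show "is_set_direct_product G M Y"
    using group.central_product_normal_transversal[OF assms Y]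
      comm_group.normal_subset_if_subset by blast
qed

end
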